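(* Let $K$ be an imaginary quadratic field or a rational quaternion field with Euclidean minimum $\mathcal{M}(K)$ and maximal order $\mathcal{O}$. Let $\Lambda$ be a lattice over $\mathcal{O}$ of dimension $d$ with basis $B=\{\mathbf{b}_1,\dots,\mathbf{b}_d\}$ that is HKZ reduced (with respect to $q$). Then for all $1\le k\le d$, $$q(\mathbf{b}_k)\le\big(1+(k-1)\mathcal{M}(K)\big)\lambda_k^2,$$ where $\lambda_k$ is the $k$-th successive minimum of $\Lambda$ with respect to $\sqrt{q}$.
   Context: A rational quaternion field is a (definite) quaternion division algebra over $\mathbb{Q}$; $K_{\mathbb{R}}=K\otimes_{\mathbb{Q}}\mathbb{R}$, $*$ denotes complex resp. quaternion conjugation, $\mathrm{nrd}_{K/\mathbb{Q}}(x)=xx^*$, and $q(\mathbf{v})=\sum_{i=1}^Dv_iv_i^*$ for $\mathbf{v}\in K_{\mathbb{R}}^D$, with associated Hermitian form $\langle\mathbf{x},\mathbf{y}\rangle=\sum_ix_iy_i^*\in K_{\mathbb{R}}$. $\mathcal{M}(K)=\sup_{x\in K_{\mathbb{R}}}\min_{y\in\mathcal{O}}\mathrm{nrd}_{K/\mathbb{Q}}(x-y)$. A lattice of dimension $d$ over $\mathcal{O}$ is $\Lambda=\bigoplus_{i=1}^d\mathcal{O}\mathbf{b}_i$, $\mathbf{b}_i\in K^D$ left-linearly independent over $K$. Gram–Schmidt data: $\mathbf{b}_1(1)=\mathbf{b}_1$, $\mathbf{b}_i(i)=\mathbf{b}_i-\sum_{j<i}\mu_{i,j}\mathbf{b}_j(j)$,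 $\mu_{i,j}=\langle\mathbf{b}_i,\mathbf{b}_j(j)\rangle\langle\mathbf{b}_j(j),\mathbf{b}_j(j)\rangle^{-1}$, and $\mathbf{b}_i(k)=\mathbf{b}_i-\sum_{j<k}\mu_{i,j}\mathbf{b}_j(j)$ for $i\ge k$. $B$ is HKZ reduced if for all $k$: (i) $\min_{(x_k,\dots,x_d)\in\mathcal{O}^{d-k+1}\setminus\{\mathbf{0}\}}q\big(\sum_{i=k}^dx_i\mathbf{b}_i(k)\big)=q(\mathbf{b}_k(k))$, and (ii) for all $i<k$, $\min_{y\in\mathcal{O}}\mathrm{nrd}(\mu_{k,i}-y)=\mathrm{nrd}(\mu_{k,i})$. The $i$-th successive minimum $\lambda_i$ is the least real number such that $\Lambda$ contains $i$ vectors, linearly independent over $K$, of norm at most $\lambda_i$. *)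

theory Defs
  imports "HOL-Analysis.Analysis"
begin

section \<open>Real division algebras with conjugation\<close>

text \<open>
  The two ambient algebras $K_{\mathbb R}$, namely the complex numbers and Hamilton's quaternions,
  are treated simultaneously through a type class. Both instances are given below; by Frobenius'
  theorem the only other model is the real line, which contains none of the fields considered.
\<close>

class star_division_algebra = real_div_algebra +
  fixes star :: "'a \<Rightarrow> 'a"
  assumes star_add: "star (x + y) = star x + star y"
    and star_mult: "star (x * y) = star y * star x"
    and star_scaleR: "star (scaleR r x) = scaleR r (star x)"
    and star_star: "star (star x) = x"
    and mult_star_real: "\<exists>r\<ge>0. x * star x = scaleR r 1"

text \<open>\<^term>\<open>x * star x\<close> lies in the copy of the reals inside the algebra; \<open>nrd x\<close> is the
  corresponding real number.\<close>

definition nrd :: "'a::star_division_algebra \<Rightarrow> real" where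
  "nrd x = (THE r. of_real r = x * star x)"

lemma of_real_nrd: "of_real (nrd x) = x * star x"
proof -
  obtain r where r: "x * star x = of_real r"
    using mult_star_real[of x] by (auto simp: of_real_def)
  then have "nrd x = r"
    unfolding nrd_def by (intro the_equality) auto
  with r show ?thesis by simp
qed

instantiation complex :: star_division_algebra
begin
definition star_complex :: "complex \<Rightarrow> complex" where "star_complex = cnj"
instance
proof
  fix x :: complex
  show "\<exists>r\<ge>0. x * star x = scaleR r 1"
    by (rule exI[of _ "(cmod x)\<^sup>2"])
       (simp add: star_complex_def complex_norm_square[symmetric] scaleR_conv_of_real)
qed (simp_all add: star_complex_def mult.commute)
end

datatype quat = Quat (qRe: real) (qI: real) (qJ: real) (qK: real)

lemma quat_eq_iff: "x = y \<longleftrightarrow> qRe x = qRe y \<and> qI x = qI y \<and> qJ x = qJ y \<and> qK x = qK y"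
  by (auto intro: quat.expand)

instantiation quat :: real_algebra_1
begin
definition "0 = Quat 0 0 0 0"
definition "1 = Quat 1 0 0 0"
definition "x + y = Quat (qRe x + qRe y) (qI x + qI y) (qJ x + qJ y) (qK x + qK y)"
definition "- x = Quat (- qRe x) (- qI x) (- qJ x) (- qK x)"
definition "x - y = Quat (qRe x - qRe y) (qI x - qI y) (qJ x - qJ y) (qK x - qK y)"
definition "scaleR r x = Quat (r * qRe x) (r * qI x) (r * qJ x) (r * qK x)"
definition "x * y = Quat
  (qRe x * qRe y - qI x * qI y - qJ x * qJ y - qK x * qK y)
  (qRe x * qI y + qI x * qRe y + qJ x * qK y - qK x * qJ y)
  (qRe x * qJ y - qI x * qK y + qJ x * qRe y + qK x * qI y)
  (qRe x * qK y + qI x * qJ y - qJ x * qI y + qK x * qRe y)"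
instance
  by standard
    (simp_all add: quat_eq_iff zero_quat_def one_quat_def plus_quat_def uminus_quat_def
      minus_quat_def scaleR_quat_def times_quat_def algebra_simps)
end

instantiation quat :: star_division_algebra
begin
definition "star x = Quat (qRe x) (- qI x) (- qJ x) (- qK x)"
definition "inverse (x::quat) =
  scaleR (inverse ((qRe x)\<^sup>2 + (qI x)\<^sup>2 + (qJ x)\<^sup>2 + (qK x)\<^sup>2)) (star x)"
definition "x div (y::quat) = x * inverse y"
instance
proof
  fix x :: quat
  let ?n = "(qRe x)\<^sup>2 + (qI x)\<^sup>2 + (qJ x)\<^sup>2 + (qK x)\<^sup>2"
  have r: "x * star x = scaleR ?n 1"
    by (simp add: quat_eq_iff star_quat_def times_quat_def scaleR_quat_def one_quat_def
        power2_eq_square algebra_simps)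
  have l: "star x * x = scaleR ?n 1"
    by (simp add: quat_eq_iff star_quat_def times_quat_def scaleR_quat_def one_quat_def
        power2_eq_square algebra_simps)
  show "\<exists>r\<ge>0. x * star x = scaleR r 1"
    using r by (intro exI[of _ ?n]) simp
  assume "x \<noteq> 0"
  have "?n \<noteq> 0"
  proof
    assume n: "?n = 0"
    have "0 \<le> (qRe x)\<^sup>2" "0 \<le> (qI x)\<^sup>2" "0 \<le> (qJ x)\<^sup>2" "0 \<le> (qK x)\<^sup>2" by simp_all
    with n have "(qRe x)\<^sup>2 = 0" "(qI x)\<^sup>2 = 0" "(qJ x)\<^sup>2 = 0" "(qK x)\<^sup>2 = 0" by linarith+
    with \<open>x \<noteq> 0\<close> show False by (simp add: quat_eq_iff zero_quat_def)
  qed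
  then show "inverse x * x = 1" "x * inverse x = 1"
    by (simp_all add: inverse_quat_def r l)
qed (simp_all add: quat_eq_iff star_quat_def times_quat_def plus_quat_def scaleR_quat_def
      inverse_quat_def divide_quat_def zero_quat_def algebra_simps)
end


section \<open>The fields and their orders\<close>

text \<open>Imaginary quadratic fields $\mathbb Q(\sqrt{-a})$.\<close>

definition imaginary_quadratic_field :: "'a::star_division_algebra set \<Rightarrow> bool" where
  "imaginary_quadratic_field K \<longleftrightarrow>
    (\<exists>a \<omega>. a \<in> \<rat> \<and> a > 0 \<and> \<omega> * \<omega> = - of_real a \<and>
       K = {of_real x + scaleR y \<omega> |x y. x \<in> \<rat> \<and> y \<in> \<rat>})"

text \<open>Definite quaternion algebras $\left(\frac{-a,-b}{\mathbb Q}\right)$ with $a,b>0$.\<close>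

definition rational_quaternion_field :: "'a::star_division_algebra set \<Rightarrow> bool" where
  "rational_quaternion_field K \<longleftrightarrow>
    (\<exists>a b i j. a \<in> \<rat> \<and> a > 0 \<and> b \<in> \<rat> \<and> b > 0 \<and>
       i * i = - of_real a \<and> j * j = - of_real b \<and> j * i = - (i * j) \<and>
       K = {of_real x + scaleR y i + scaleR z j + scaleR w (i * j) |x y z w.
              x \<in> \<rat> \<and> y \<in> \<rat> \<and> z \<in> \<rat> \<and> w \<in> \<rat>})"

definition is_order :: "'a::star_division_algebra set \<Rightarrow> 'a set \<Rightarrow> bool" where
  "is_order K \<O> \<longleftrightarrow> \<O> \<subseteq> K \<and> 1 \<in> \<O> \<and> (\<forall>x\<in>\<O>. \<forall>y\<in>\<O>. x - y \<in> \<O> \<and> x * y \<in> \<O>) \<and>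
     (\<exists>S. finite S \<and> \<O> = {\<Sum>s\<in>S. of_int (c s) * s |c. True}) \<and>
     (\<forall>x\<in>K. \<exists>n::nat. n > 0 \<and> of_nat n * x \<in> \<O>)"

definition maximal_order :: "'a::star_division_algebra set \<Rightarrow> 'a set \<Rightarrow> bool" where
  "maximal_order K \<O> \<longleftrightarrow> is_order K \<O> \<and> (\<forall>\<O>'. is_order K \<O>' \<and> \<O> \<subseteq> \<O>' \<longrightarrow> \<O>' = \<O>)"

text \<open>
  In both cases a \<open>\<rat>\<close>-basis of \<open>K\<close> is linearly independent over the reals, so the real span
  of \<open>K\<close> is $K\otimes_{\mathbb Q}\mathbb R$. The inner minimum is attained, because an order is
  discrete in its real span, and is therefore written as an infimum.
\<close>

definition euclidean_minimum :: "'a::star_division_algebra set \<Rightarrow> 'a set \<Rightarrow> real" where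
  "euclidean_minimum K \<O> = (SUP x\<in>span K. INF y\<in>\<O>. nrd (x - y))"


section \<open>Lattices and reduction\<close>

text \<open>\<^term>\<open>c *s v\<close> multiplies each coordinate of \<open>v\<close> by \<open>c\<close> from the left, so all modules are
  left modules. Basis vectors are indexed from 1.\<close>

definition hform :: "'a::star_division_algebra ^ 'm \<Rightarrow> 'a ^ 'm \<Rightarrow> 'a" where
  "hform x y = (\<Sum>i\<in>UNIV. x $ i * star (y $ i))"

definition q :: "'a::star_division_algebra ^ 'm \<Rightarrow> real" where
  "q v = (\<Sum>i\<in>UNIV. nrd (v $ i))"

definition left_independent ::
    "'a::star_division_algebra set \<Rightarrow> nat \<Rightarrow> (nat \<Rightarrow> 'a ^ 'm) \<Rightarrow> bool" where
  "left_independent K n v \<longleftrightarrow>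
    (\<forall>c. (\<forall>i\<in>{1..n}. c i \<in> K) \<and> (\<Sum>i\<in>{1..n}. c i *s v i) = 0 \<longrightarrow> (\<forall>i\<in>{1..n}. c i = 0))"

definition lattice_basis ::
    "'a::star_division_algebra set \<Rightarrow> 'a set \<Rightarrow> nat \<Rightarrow> (nat \<Rightarrow> 'a ^ 'm) \<Rightarrow> ('a ^ 'm) set \<Rightarrow> bool" where
  "lattice_basis K \<O> d b \<Lambda> \<longleftrightarrow>
     (\<forall>i\<in>{1..d}. \<forall>j. b i $ j \<in> K) \<and> left_independent K d b \<and>
     \<Lambda> = {\<Sum>i\<in>{1..d}. x i *s b i |x. \<forall>i\<in>{1..d}. x i \<in> \<O>}"

text \<open>\<open>gs b i k\<close> is $\mathbf b_i(k)$, for \<open>1 \<le> k \<le> i\<close>.\<close>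

fun gs :: "(nat \<Rightarrow> 'a::star_division_algebra ^ 'm) \<Rightarrow> nat \<Rightarrow> nat \<Rightarrow> 'a ^ 'm" where
  "gs b i k = b i -
     (\<Sum>j\<in>{1..<k}. (hform (b i) (gs b j j) * inverse (hform (gs b j j) (gs b j j))) *s gs b j j)"

declare gs.simps [simp del]

definition gs_mu :: "(nat \<Rightarrow> 'a::star_division_algebra ^ 'm) \<Rightarrow> nat \<Rightarrow> nat \<Rightarrow> 'a" where
  "gs_mu b i j = hform (b i) (gs b j j) * inverse (hform (gs b j j) (gs b j j))"

definition is_min :: "real set \<Rightarrow> real \<Rightarrow> bool" where
  "is_min S m \<longleftrightarrow> m \<in> S \<and> (\<forall>s\<in>S. m \<le> s)"

definition hkz_reduced ::
    "'a::star_division_algebra set \<Rightarrow> nat \<Rightarrow> (nat \<Rightarrow> 'a ^ 'm) \<Rightarrow> bool" where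
  "hkz_reduced \<O> d b \<longleftrightarrow> (\<forall>k\<in>{1..d}.
     is_min {q (\<Sum>i\<in>{k..d}. x i *s gs b i k) |x.
               (\<forall>i\<in>{k..d}. x i \<in> \<O>) \<and> (\<exists>i\<in>{k..d}. x i \<noteq> 0)}
            (q (gs b k k)) \<and>
     (\<forall>i\<in>{1..<k}. is_min {nrd (gs_mu b k i - y) |y. y \<in> \<O>} (nrd (gs_mu b k i))))"

text \<open>The least admissible \<open>r\<close> exists for \<open>1 \<le> i \<le> d\<close>, because a lattice is discrete; it is
  written as an infimum.\<close>

definition successive_minimum ::
    "'a::star_division_algebra set \<Rightarrow> ('a ^ 'm) set \<Rightarrow> nat \<Rightarrow> real" where
  "successive_minimum K \<Lambda> i = Inf {r. \<exists>v. (\<forall>j\<in>{1..i}. v j \<in> \<Lambda> \<and> sqrt (q (v j)) \<le> r) \<and>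
     left_independent K i v}"

end

(* Expanding b_k along the Gram-Schmidt vectors gives
   q(b_k) = q(b_k(k)) + sum_{i<k} nrd(mu_{k,i}) q(b_i(i)).  The size reduction condition bounds each
   nrd(mu_{k,i}) by the Euclidean minimum.  Among k independent lattice vectors at least one has a
   nonzero coordinate at some index l >= i, by counting dimensions over the skew field K; projecting
   it orthogonally to b_1, ..., b_{i-1} does not increase q, so the minimality condition
   gives q(b_i(i)) <= lambda_k^2 for all i <= k. *)
theory Submission
  imports Defs
begin

section \<open>Conjugation and reduced norm\<close>

lemma star_zero [simp]: "star 0 = (0::'a::star_division_algebra)"
  using star_scaleR[of 0 "0::'a"] by simp

lemma star_minus: "star (- x) = - star (x::'a::star_division_algebra)"
  using star_scaleR[of "-1" x] by simp

lemma star_diff: "star (x - y) = star x - star (y::'a::star_division_algebra)"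
  using star_add[of x "- y"] by (simp add: star_minus)

lemma star_one [simp]: "star 1 = (1::'a::star_division_algebra)"
  by (metis mult_1 mult_1_right star_mult star_star)

lemma star_of_real [simp]: "star (of_real r) = (of_real r::'a::star_division_algebra)"
  by (simp add: of_real_def star_scaleR)

lemma star_sum: "star (sum f A) = (\<Sum>i\<in>A. star (f i :: 'a::star_division_algebra))"
  by (induction A rule: infinite_finite_induct) (simp_all add: star_add)

lemma star_eq_0_iff [simp]: "star x = 0 \<longleftrightarrow> (x::'a::star_division_algebra) = 0"
  by (metis star_star star_zero)

lemma nrd_eqI: "x * star x = of_real r \<Longrightarrow> nrd x = r"
  by (metis of_real_nrd of_real_eq_iff)

lemma nrd_nonneg [simp]: "0 \<le> nrd x"
  by (metis mult_star_real nrd_eqI of_real_def)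

lemma nrd_zero [simp]: "nrd 0 = 0"
  by (rule nrd_eqI) simp

lemma nrd_eq_0_iff [simp]: "nrd x = 0 \<longleftrightarrow> x = 0"
  by (metis mult_eq_0_iff nrd_zero of_real_0 of_real_nrd star_eq_0_iff)

text \<open>Real scalars are central, so the inner factor \<open>y * star y\<close> can be pulled
  out of the middle of the product.\<close>

lemma nrd_mult: "nrd (x * y) = nrd x * nrd y"
proof (rule nrd_eqI)
  have "x * y * star (x * y) = x * (y * star y) * star x"
    by (simp add: star_mult mult.assoc)
  also have "\<dots> = of_real (nrd y) * (x * star x)"
    by (simp add: of_real_nrd[symmetric] of_real_def)
  finally show "x * y * star (x * y) = of_real (nrd x * nrd y)"
    by (simp add: of_real_nrd[symmetric] mult.commute[of "nrd x" "nrd y"])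
qed

lemma nrd_scaleR: "nrd (scaleR t x) = t\<^sup>2 * nrd x"
  by (rule nrd_eqI) (simp add: star_scaleR of_real_nrd[symmetric] power2_eq_square of_real_def)

text \<open>Parallelogram law with the nonnegative term \<open>nrd (x - y)\<close> dropped; it
  replaces the triangle inequality in the covering argument.\<close>

lemma nrd_add_le: "nrd (x + y) \<le> 2 * nrd x + 2 * nrd (y::'a::star_division_algebra)"
proof -
  have "(of_real (nrd (x + y) + nrd (x - y)) :: 'a) =
      of_real ((nrd x + nrd y) + (nrd x + nrd y))"
    by (simp add: of_real_nrd star_add star_diff algebra_simps)
      (simp only: mult_2_right distrib_left add_ac)
  then have "nrd (x + y) + nrd (x - y) = (nrd x + nrd y) + (nrd x + nrd y)"
    by (simp only: of_real_eq_iff)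
  then show ?thesis
    using nrd_nonneg[of "x - y"] by linarith
qed

lemma inverse_eq_star: "inverse x = of_real (inverse (nrd x)) * star x"
proof (cases "x = 0")
  case False
  then have "x * (of_real (inverse (nrd x)) * star x) = 1"
    by (simp add: of_real_def of_real_nrd[symmetric] flip: of_real_mult)
  then show ?thesis
    by (rule inverse_unique)
qed simp

text \<open>If $\omega^2 = -a$, then $\omega^* = s\,\omega^{-1}$ is a negative multiple $c\,\omega$;
  applying the involution twice gives $c^2 = 1$.\<close>

lemma star_of_negative_square:
  fixes \<omega> :: "'a::star_division_algebra"
  assumes "\<omega> * \<omega> = - of_real a" "a > 0"
  shows "star \<omega> = - \<omega>"
proof -
  define c where "c = - (nrd \<omega> / a)"
  have "\<omega> \<noteq> 0"
    using assms by auto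
  have "\<omega> * star \<omega> = \<omega> * scaleR c \<omega>"
    using assms by (simp add: of_real_nrd[symmetric] c_def of_real_def)
  then have star: "star \<omega> = scaleR c \<omega>"
    using \<open>\<omega> \<noteq> 0\<close> mult_left_cancel by blast
  have "\<omega> = scaleR (c * c) \<omega>"
    by (metis star star_scaleR star_star scaleR_scaleR)
  then have "c * c = 1"
    using \<open>\<omega> \<noteq> 0\<close> by (metis scaleR_cancel_right scaleR_one)
  moreover have "c \<le> 0"
    using assms(2) by (simp add: c_def)
  ultimately have "c = -1"
    by (simp add: square_eq_1_iff)
  then show ?thesis
    by (simp add: star)
qed


section \<open>The two kinds of fields\<close>

text \<open>Isolates the closure properties used by Gram-Schmidt orthogonalisation and by
  elimination over a skew field, so that both kinds of fields share the later arguments. Closure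
  under \<open>star\<close> keeps values of \<open>hform\<close> in \<open>K\<close>.\<close>

locale star_subfield =
  fixes K :: "'a::star_division_algebra set"
  assumes one_closed: "1 \<in> K"
    and diff_closed: "x \<in> K \<Longrightarrow> y \<in> K \<Longrightarrow> x - y \<in> K"
    and mult_closed: "x \<in> K \<Longrightarrow> y \<in> K \<Longrightarrow> x * y \<in> K"
    and star_closed: "x \<in> K \<Longrightarrow> star x \<in> K"
    and inverse_closed: "x \<in> K \<Longrightarrow> inverse x \<in> K"
begin

lemma zero_closed: "0 \<in> K"
  using diff_closed[OF one_closed one_closed] by simp

lemma uminus_closed: "x \<in> K \<Longrightarrow> - x \<in> K"
  using diff_closed[OF zero_closed] by simp

lemma add_closed: "x \<in> K \<Longrightarrow> y \<in> K \<Longrightarrow> x + y \<in> K"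
  using diff_closed[of x "- y"] uminus_closed by simp

lemma sum_closed: "(\<And>i. i \<in> A \<Longrightarrow> f i \<in> K) \<Longrightarrow> sum f A \<in> K"
  by (induction A rule: infinite_finite_induct) (auto intro: zero_closed add_closed)

lemma hform_closed: "(\<And>j. v $ j \<in> K) \<Longrightarrow> (\<And>j. w $ j \<in> K) \<Longrightarrow> hform v w \<in> K"
  unfolding hform_def by (intro sum_closed mult_closed star_closed) auto

text \<open>Strong induction on \<open>k\<close> with \<open>i\<close> arbitrary, because
  \<open>gs b i k\<close> recurs to the diagonal vectors \<open>gs b j j\<close> with
  \<open>j < k\<close>.\<close>

lemma gs_closed: "(\<And>l j. l \<in> {1..d} \<Longrightarrow> b l $ j \<in> K) \<Longrightarrow> i \<in> {1..d} \<Longrightarrow> k \<le> d \<Longrightarrow> gs b i k $ j \<in> K"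
proof (induction k arbitrary: i j rule: less_induct)
  case (less k)
  then show ?case
    unfolding gs.simps[of b i k]
    by (auto intro!: diff_closed sum_closed mult_closed inverse_closed hform_closed)
qed

lemma gs_mu_closed:
  "(\<And>l j. l \<in> {1..d} \<Longrightarrow> b l $ j \<in> K) \<Longrightarrow> i \<in> {1..d} \<Longrightarrow> k \<in> {1..d} \<Longrightarrow> gs_mu b i k \<in> K"
  unfolding gs_mu_def
  by (intro mult_closed inverse_closed hform_closed gs_closed[where d = d]) auto

end

text \<open>An inverse is the conjugate divided by \<open>nrd\<close>, so rationality of
  \<open>nrd\<close> on \<open>K\<close> yields closure under inverses.\<close>

lemma star_subfieldI:
  assumes rat: "\<And>r. r \<in> \<rat> \<Longrightarrow> of_real r \<in> K"
    and "\<And>x y. x \<in> K \<Longrightarrow> y \<in> K \<Longrightarrow> x - y \<in> K"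
    and mult: "\<And>x y. x \<in> K \<Longrightarrow> y \<in> K \<Longrightarrow> x * y \<in> K"
    and star: "\<And>x. x \<in> K \<Longrightarrow> star x \<in> K"
    and nrd: "\<And>x. x \<in> K \<Longrightarrow> nrd x \<in> \<rat>"
  shows "star_subfield K"
proof
  show "1 \<in> K"
    using rat[of 1] by simp
  show "inverse x \<in> K" if "x \<in> K" for x
    unfolding inverse_eq_star by (intro mult rat star nrd that Rats_inverse)
qed (use assms in auto)

text \<open>Explicit coordinate formulas show that rational coordinates are preserved. The finite
  real spanning set later makes the supremum in the Euclidean minimum finite.\<close>

lemma imaginary_quadratic_field_properties:
  assumes "imaginary_quadratic_field K"
  shows "star_subfield K" and "\<exists>E. finite E \<and> E \<subseteq> K \<and> K \<subseteq> span E"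
proof -
  obtain a \<omega> where a: "a \<in> \<rat>" "a > 0" and \<omega>: "\<omega> * \<omega> = - of_real a"
    and K: "K = {of_real x + scaleR y \<omega> |x y. x \<in> \<rat> \<and> y \<in> \<rat>}"
    using assms unfolding imaginary_quadratic_field_def by blast
  \<comment> \<open>The coordinates are arbitrary reals; \<open>K\<close> is the part with rational
    ones.\<close>
  define el where "el x y = scaleR x 1 + scaleR y \<omega>" for x y
  have K_iff: "u \<in> K \<longleftrightarrow> (\<exists>x\<in>\<rat>. \<exists>y\<in>\<rat>. u = el x y)" for u
    unfolding K el_def of_real_def by auto
  have mult: "el x y * el x' y' = el (x * x' - a * (y * y')) (x * y' + y * x')" for x y x' y'
    using \<omega> by (simp add: el_def of_real_def algebra_simps)
  have star: "star (el x y) = el x (- y)" for x y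
    using star_of_negative_square[OF \<omega> a(2)] by (simp add: el_def star_add star_scaleR)
  have nrd: "nrd (el x y) = x * x + a * (y * y)" for x y
    by (rule nrd_eqI) (simp add: star mult, simp add: el_def of_real_def algebra_simps)
  have el: "el x y \<in> K" if "x \<in> \<rat>" "y \<in> \<rat>" for x y
    using that K_iff by blast
  show "star_subfield K"
  proof (rule star_subfieldI)
    show "of_real r \<in> K" if "r \<in> \<rat>" for r
      using el[OF that, of 0] by (simp add: el_def of_real_def)
    fix u v assume "u \<in> K" "v \<in> K"
    then obtain x y x' y' where uv: "u = el x y" "v = el x' y'"
      and rat: "x \<in> \<rat>" "y \<in> \<rat>" "x' \<in> \<rat>" "y' \<in> \<rat>"
      unfolding K_iff by blast
    have "u - v = el (x - x') (y - y')"
      by (simp add: uv el_def algebra_simps)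
    then show "u - v \<in> K"
      using rat by (auto intro!: el)
    show "u * v \<in> K"
      unfolding uv mult using rat a by (auto intro!: el)
  next
    fix u assume "u \<in> K"
    then obtain x y where u: "u = el x y" and rat: "x \<in> \<rat>" "y \<in> \<rat>"
      unfolding K_iff by blast
    show "star u \<in> K"
      unfolding u star using rat by (auto intro!: el)
    show "nrd u \<in> \<rat>"
      unfolding u nrd using rat a by auto
  qed
  have "1 = el 1 0" "\<omega> = el 0 1"
    by (simp_all add: el_def)
  then have "{1, \<omega>} \<subseteq> K"
    using el by (metis Rats_0 Rats_1 empty_subsetI insert_subset)
  moreover have "K \<subseteq> span {1, \<omega>}"
    unfolding K of_real_def by (auto intro!: span_add span_scale intro: span_base)
  ultimately show "\<exists>E. finite E \<and> E \<subseteq> K \<and> K \<subseteq> span E"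
    by (intro exI[of _ "{1, \<omega>}"]) simp
qed

lemma rational_quaternion_field_properties:
  assumes "rational_quaternion_field K"
  shows "star_subfield K" and "\<exists>E. finite E \<and> E \<subseteq> K \<and> K \<subseteq> span E"
proof -
  obtain a b i j where ab: "a \<in> \<rat>" "a > 0" "b \<in> \<rat>" "b > 0"
    and ij: "i * i = - of_real a" "j * j = - of_real b" "j * i = - (i * j)"
    and K: "K = {of_real x + scaleR y i + scaleR z j + scaleR w (i * j) |x y z w.
              x \<in> \<rat> \<and> y \<in> \<rat> \<and> z \<in> \<rat> \<and> w \<in> \<rat>}"
    using assms unfolding rational_quaternion_field_def by blast
  define el where "el x y z w = scaleR x 1 + scaleR y i + scaleR z j + scaleR w (i * j)" for x y z w
  have K_iff: "u \<in> K \<longleftrightarrow> (\<exists>x\<in>\<rat>. \<exists>y\<in>\<rat>. \<exists>z\<in>\<rat>. \<exists>w\<in>\<rat>. u = el x y z w)" for u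
    unfolding K el_def of_real_def by auto
  \<comment> \<open>With a trailing factor \<open>u\<close>, these relations apply inside
    right-associated products: they move every \<open>i\<close> to the left of \<open>j\<close> and
    collapse squares.\<close>
  have ij_left: "i * (i * u) = scaleR (- a) u" "j * (j * u) = scaleR (- b) u"
    "j * (i * u) = - (i * (j * u))" for u
    using ij by (simp_all add: mult.assoc[symmetric] of_real_def)
  have mult: "el x y z w * el x' y' z' w' =
      el (x * x' - a * (y * y') - b * (z * z') - a * b * (w * w'))
         (x * y' + y * x' + b * (z * w') - b * (w * z'))
         (x * z' + z * x' - a * (y * w') + a * (w * y'))
         (x * w' + w * x' + y * z' - z * y')" for x y z w x' y' z' w'
    unfolding el_def by (simp add: ij ij_left of_real_def algebra_simps)
  \<comment> \<open>The conjugate of \<open>i * j\<close> then follows: it equals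
    \<open>j * i\<close>, that is \<open>- (i * j)\<close>.\<close>
  have "star i = - i" "star j = - j"
    using star_of_negative_square ij ab by blast+
  then have star: "star (el x y z w) = el x (- y) (- z) (- w)" for x y z w
    by (simp add: el_def star_add star_scaleR star_mult ij)
  have nrd: "nrd (el x y z w) = x * x + a * (y * y) + b * (z * z) + a * b * (w * w)" for x y z w
    by (rule nrd_eqI) (simp add: star mult, simp add: el_def of_real_def algebra_simps)
  have el: "el x y z w \<in> K" if "x \<in> \<rat>" "y \<in> \<rat>" "z \<in> \<rat>" "w \<in> \<rat>" for x y z w
    using that K_iff by blast
  show "star_subfield K"
  proof (rule star_subfieldI)
    show "of_real r \<in> K" if "r \<in> \<rat>" for r
      using el[OF that, of 0 0 0] by (simp add: el_def of_real_def)
    fix u v assume "u \<in> K" "v \<in> K"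
    then obtain x y z w x' y' z' w' where uv: "u = el x y z w" "v = el x' y' z' w'"
      and rat: "x \<in> \<rat>" "y \<in> \<rat>" "z \<in> \<rat>" "w \<in> \<rat>" "x' \<in> \<rat>" "y' \<in> \<rat>" "z' \<in> \<rat>" "w' \<in> \<rat>"
      unfolding K_iff by blast
    have "u - v = el (x - x') (y - y') (z - z') (w - w')"
      by (simp add: uv el_def algebra_simps)
    then show "u - v \<in> K"
      using rat by (auto intro!: el)
    show "u * v \<in> K"
      unfolding uv mult using rat ab by (auto intro!: el)
  next
    fix u assume "u \<in> K"
    then obtain x y z w where u: "u = el x y z w" and rat: "x \<in> \<rat>" "y \<in> \<rat>" "z \<in> \<rat>" "w \<in> \<rat>"
      unfolding K_iff by blast
    show "star u \<in> K"
      unfolding u star using rat by (auto intro!: el)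
    show "nrd u \<in> \<rat>"
      unfolding u nrd using rat ab by auto
  qed
  have "1 = el 1 0 0 0" "i = el 0 1 0 0" "j = el 0 0 1 0" "i * j = el 0 0 0 1"
    by (simp_all add: el_def)
  then have "{1, i, j, i * j} \<subseteq> K"
    using el by (metis Rats_0 Rats_1 empty_subsetI insert_subset)
  moreover have "K \<subseteq> span {1, i, j, i * j}"
    unfolding K of_real_def by (auto intro!: span_add span_scale intro: span_base)
  ultimately show "\<exists>E. finite E \<and> E \<subseteq> K \<and> K \<subseteq> span E"
    by (intro exI[of _ "{1, i, j, i * j}"]) simp
qed


section \<open>The Euclidean minimum\<close>

lemma is_orderD:
  assumes "is_order K \<O>"
  shows "\<O> \<subseteq> K" "0 \<in> \<O>" "1 \<in> \<O>"
    and "\<And>x y. x \<in> \<O> \<Longrightarrow> y \<in> \<O> \<Longrightarrow> x + y \<in> \<O>"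
    and "\<And>m x. x \<in> \<O> \<Longrightarrow> of_int m * x \<in> \<O>"
    and "\<And>x. x \<in> K \<Longrightarrow> \<exists>n::nat. n > 0 \<and> of_nat n * x \<in> \<O>"
proof -
  have diff: "x - y \<in> \<O>" if "x \<in> \<O>" "y \<in> \<O>" for x y
    using assms that unfolding is_order_def by auto
  show one: "1 \<in> \<O>" and "\<O> \<subseteq> K"
    and "\<And>x. x \<in> K \<Longrightarrow> \<exists>n::nat. n > 0 \<and> of_nat n * x \<in> \<O>"
    using assms unfolding is_order_def by auto
  have mult: "\<And>x y. x \<in> \<O> \<Longrightarrow> y \<in> \<O> \<Longrightarrow> x * y \<in> \<O>"
    using assms unfolding is_order_def by auto
  show zero: "0 \<in> \<O>"
    using diff[OF one one] by simp
  show add: "x + y \<in> \<O>" if "x \<in> \<O>" "y \<in> \<O>" for x y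
    using diff[OF that(1) diff[OF zero that(2)]] by simp
  have "of_int m \<in> \<O>" for m
    by (induction m rule: int_induct[where k = 0]) (auto intro: zero one add diff)
  then show "\<And>m x. x \<in> \<O> \<Longrightarrow> of_int m * x \<in> \<O>"
    using mult by blast
qed

text \<open>The covering radius is finite. Adjoining \<open>e\<close> to the spanning set, some
  multiple \<open>n * e\<close> with \<open>n > 0\<close> lies in the order, so the real coefficient
  of \<open>e\<close> can be reduced modulo \<open>n\<close>.\<close>

lemma order_covering:
  assumes ord: "is_order K \<O>" and "finite E" "E \<subseteq> K"
  shows "\<exists>C. \<forall>x\<in>span E. \<exists>y\<in>\<O>. nrd (x - y) \<le> C"
  using assms(2,3)
proof (induction E rule: finite_induct)
  case empty
  show ?case
    using is_orderD(2)[OF ord] by (intro exI[of _ 0]) (auto intro!: bexI[of _ 0])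
next
  case (insert e E)
  then obtain C where C: "\<And>x. x \<in> span E \<Longrightarrow> \<exists>y\<in>\<O>. nrd (x - y) \<le> C"
    by auto
  obtain n :: nat where n: "n > 0" "of_nat n * e \<in> \<O>"
    using is_orderD(6)[OF ord] insert.prems by auto
  have "\<exists>y\<in>\<O>. nrd (x - y) \<le> 2 * C + 2 * ((real n)\<^sup>2 * nrd e)" if x: "x \<in> span (insert e E)" for x
  proof -
    obtain k where "x - scaleR k e \<in> span E"
      using x unfolding span_insert by blast
    then obtain y where y: "y \<in> \<O>" "nrd (x - scaleR k e - y) \<le> C"
      using C by blast
    \<comment> \<open>Division with remainder of the real \<open>k\<close> by \<open>n\<close>: the
      multiple \<open>m * n * e\<close> is absorbed into the order, and the remainder
      \<open>t\<close> is at most \<open>n\<close>.\<close>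
    define m where "m = \<lfloor>k / real n\<rfloor>"
    define t where "t = k - of_int m * real n"
    have "of_int m \<le> k / real n" "k / real n < of_int m + 1"
      unfolding m_def by linarith+
    then have "0 \<le> t" "t \<le> real n"
      using n by (auto simp: t_def field_simps)
    then have t: "t\<^sup>2 * nrd e \<le> (real n)\<^sup>2 * nrd e"
      by (intro mult_right_mono power_mono) auto
    have "of_int m * (of_nat n * e) = scaleR (of_int m * real n) e"
      by (simp add: scaleR_conv_of_real mult.assoc)
    then have "x - (y + of_int m * (of_nat n * e)) = (x - scaleR k e - y) + scaleR t e"
      by (simp add: t_def algebra_simps)
    then have "nrd (x - (y + of_int m * (of_nat n * e))) \<le>
        2 * nrd (x - scaleR k e - y) + 2 * (t\<^sup>2 * nrd e)"
      by (metis nrd_add_le nrd_scaleR)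
    moreover have "y + of_int m * (of_nat n * e) \<in> \<O>"
      using is_orderD[OF ord] n y by blast
    ultimately show ?thesis
      using y t by (intro bexI) auto
  qed
  then show ?case
    by blast
qed

text \<open>A real supremum bounds its members only if the family is bounded above; the covering
  lemma supplies one constant valid on all of \<open>span K\<close>.\<close>

lemma INF_nrd_le_euclidean_minimum:
  assumes ord: "is_order K \<O>" and E: "finite E" "E \<subseteq> K" "K \<subseteq> span E" and x: "x \<in> K"
  shows "(INF y\<in>\<O>. nrd (x - y)) \<le> euclidean_minimum K \<O>"
proof -
  obtain C where C: "\<And>x. x \<in> span E \<Longrightarrow> \<exists>y\<in>\<O>. nrd (x - y) \<le> C"
    using order_covering[OF ord E(1,2)] by blast
  have bdd: "bdd_below ((\<lambda>y. nrd (x - y)) ` \<O>)" for x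
    by (rule bdd_belowI[of _ 0]) auto
  have "(INF y\<in>\<O>. nrd (x - y)) \<le> C" if "x \<in> span K" for x
  proof -
    have "x \<in> span E"
      using that E(3) by (meson span_minimal subspace_span subsetD)
    with C obtain y where "y \<in> \<O>" "nrd (x - y) \<le> C"
      by blast
    then show ?thesis
      using cINF_lower[OF bdd] order_trans by blast
  qed
  then have "bdd_above ((\<lambda>x. INF y\<in>\<O>. nrd (x - y)) ` span K)"
    by (intro bdd_aboveI2)
  then show ?thesis
    unfolding euclidean_minimum_def using x by (intro cSUP_upper span_base)
qed

text \<open>The minimality hypothesis says that \<open>0\<close> is a closest element of the order
  to \<open>x\<close>, so \<open>nrd x\<close> is at most the infimum of the distances.\<close>

lemma is_min_nrd_le_euclidean_minimum:
  assumes "is_order K \<O>" "finite E" "E \<subseteq> K" "K \<subseteq> span E" "x \<in> K"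
    and "is_min {nrd (x - y) |y. y \<in> \<O>} (nrd x)"
  shows "nrd x \<le> euclidean_minimum K \<O>"
proof -
  have "nrd x \<le> (INF y\<in>\<O>. nrd (x - y))"
    using assms(6) is_orderD(2)[OF assms(1)] by (intro cINF_greatest) (auto simp: is_min_def)
  also have "\<dots> \<le> euclidean_minimum K \<O>"
    using assms by (intro INF_nrd_le_euclidean_minimum)
  finally show ?thesis .
qed


section \<open>Hermitian form and Gram--Schmidt vectors\<close>

lemma hform_add_left: "hform (u + v) w = hform u w + hform v w"
  by (simp add: hform_def distrib_right sum.distrib)

lemma hform_add_right: "hform u (v + w) = hform u v + hform u w"
  by (simp add: hform_def star_add distrib_left sum.distrib)

lemma hform_scale_left: "hform (c *s v) w = c * hform v w"
  by (simp add: hform_def sum_distrib_left mult.assoc)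

lemma hform_scale_right: "hform v (c *s w) = hform v w * star c"
  by (simp add: hform_def sum_distrib_right star_mult mult.assoc)

lemma hform_zero_left [simp]: "hform 0 w = 0"
  by (simp add: hform_def)

lemma hform_zero_right [simp]: "hform w 0 = 0"
  by (simp add: hform_def)

lemma hform_sum_left: "hform (sum f A) w = (\<Sum>i\<in>A. hform (f i) w)"
  by (induction A rule: infinite_finite_induct) (simp_all add: hform_add_left)

lemma hform_sum_right: "hform w (sum f A) = (\<Sum>i\<in>A. hform w (f i))"
  by (induction A rule: infinite_finite_induct) (simp_all add: hform_add_right)

lemma star_hform: "star (hform v w) = hform w v"
  by (simp add: hform_def star_sum star_mult star_star)

lemma hform_self: "hform v v = of_real (q v)"
  by (simp add: hform_def q_def of_real_nrd)

lemma q_nonneg [simp]: "0 \<le> q v"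
  by (simp add: q_def sum_nonneg)

lemma q_zero [simp]: "q 0 = 0"
  by (simp add: q_def)

lemma q_eq_0_iff: "q v = 0 \<longleftrightarrow> v = 0"
  by (simp add: q_def sum_nonneg_eq_0_iff vec_eq_iff)

lemma q_scale: "q (c *s v) = nrd c * q v"
  by (simp add: q_def nrd_mult sum_distrib_left)

text \<open>Pythagoras: one mixed term vanishes by assumption, and the other is its
  conjugate.\<close>

lemma q_add_orthogonal:
  fixes v w :: "'a::star_division_algebra ^ 'm"
  assumes "hform v w = 0"
  shows "q (v + w) = q v + q w"
proof -
  have "hform w v = 0"
    using star_hform[of v w] assms by simp
  then have "(of_real (q (v + w)) :: 'a) = of_real (q v + q w)"
    using assms by (simp add: hform_self[symmetric] hform_add_left hform_add_right)
  then show ?thesis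
    by (simp only: of_real_eq_iff)
qed

lemma q_sum_orthogonal:
  assumes "finite A" "\<And>i j. i \<in> A \<Longrightarrow> j \<in> A \<Longrightarrow> i \<noteq> j \<Longrightarrow> hform (f i) (f j) = 0"
  shows "q (sum f A) = (\<Sum>i\<in>A. q (f i))"
  using assms
proof (induction A rule: finite_induct)
  case (insert x A)
  have "hform (f x) (sum f A) = 0"
    unfolding hform_sum_right using insert by (intro sum.neutral) auto
  then show ?case
    using insert by (simp add: q_add_orthogonal)
qed simp

section \<open>Orthogonality of the Gram-Schmidt vectors and its consequences for lengths\<close>

lemma gs_eq: "gs b i k = b i - (\<Sum>j\<in>{1..<k}. gs_mu b i j *s gs b j j)"
  by (simp add: gs.simps[of b i k] gs_mu_def)

text \<open>By strong induction the earlier diagonal vectors are pairwise orthogonal. Pairing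
  \<open>b l\<close> with \<open>gs b j j\<close> therefore leaves just one term of the subtracted
  sum, and it equals \<open>hform (b l) (gs b j j)\<close>.\<close>

lemma gs_orthogonal:
  "1 \<le> j \<Longrightarrow> j < k \<Longrightarrow> hform (gs b l k) (gs b j j) = 0"
proof (induction k arbitrary: j l rule: less_induct)
  case (less k)
  \<comment> \<open>The induction hypothesis is applied at the larger of the two indices; if that is
    \<open>j\<close>, conjugation restores the order of the arguments.\<close>
  have orth: "hform (gs b i i) (gs b j j) = 0" if "i \<in> {1..<k}" "i \<noteq> j" for i
  proof (cases "j < i")
    case True
    with that less show ?thesis by auto
  next
    case False
    then have "hform (gs b j j) (gs b i i) = 0"
      using that less by auto
    then show ?thesis
      using star_hform[of "gs b j j" "gs b i i"] by simp
  qed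
  \<comment> \<open>If \<open>gs b j j\<close> is zero, both sides vanish; otherwise definiteness of
    \<open>q\<close> makes the inverse cancel.\<close>
  have mu: "gs_mu b l j * hform (gs b j j) (gs b j j) = hform (b l) (gs b j j)"
  proof (cases "gs b j j = 0")
    case False
    then have "hform (gs b j j) (gs b j j) \<noteq> 0"
      by (simp add: hform_self q_eq_0_iff)
    then show ?thesis
      by (simp add: gs_mu_def mult.assoc)
  qed simp
  have "b l = gs b l k + (\<Sum>i\<in>{1..<k}. gs_mu b l i *s gs b i i)"
    by (simp add: gs_eq[of b l k])
  then have "hform (b l) (gs b j j) =
      hform (gs b l k) (gs b j j) + (\<Sum>i\<in>{1..<k}. gs_mu b l i * hform (gs b i i) (gs b j j))"
    by (metis (no_types, lifting) hform_add_left hform_sum_left hform_scale_left sum.cong)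
  also have "(\<Sum>i\<in>{1..<k}. gs_mu b l i * hform (gs b i i) (gs b j j)) =
      (\<Sum>i\<in>{1..<k}. if i = j then hform (b l) (gs b j j) else 0)"
    using orth mu by (intro sum.cong) auto
  also have "\<dots> = hform (b l) (gs b j j)"
    using less.prems by simp
  finally show ?case
    by simp
qed

lemma gs_orthogonal_neq:
  assumes "1 \<le> i" "1 \<le> j" "i \<noteq> j"
  shows "hform (gs b i i) (gs b j j) = 0"
proof (cases "j < i")
  case False
  then have "hform (gs b j j) (gs b i i) = 0"
    using assms by (intro gs_orthogonal) auto
  then show ?thesis
    using star_hform[of "gs b j j" "gs b i i"] by simp
qed (use assms gs_orthogonal in auto)

text \<open>Pythagoras twice: first to split off \<open>gs b k k\<close>, then along the pairwise
  orthogonal earlier directions.\<close>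

lemma q_basis_eq:
  assumes "1 \<le> k"
  shows "q (b k) = q (gs b k k) + (\<Sum>i\<in>{1..<k}. nrd (gs_mu b k i) * q (gs b i i))"
proof -
  let ?s = "\<Sum>i\<in>{1..<k}. gs_mu b k i *s gs b i i"
  have "hform (gs b k k) ?s = 0"
    unfolding hform_sum_right by (intro sum.neutral) (simp add: hform_scale_right gs_orthogonal)
  then have "q (gs b k k + ?s) = q (gs b k k) + q ?s"
    by (rule q_add_orthogonal)
  moreover have "q ?s = (\<Sum>i\<in>{1..<k}. q (gs_mu b k i *s gs b i i))"
    by (rule q_sum_orthogonal) (auto simp: hform_scale_left hform_scale_right gs_orthogonal_neq)
  moreover have "b k = gs b k k + ?s"
    by (simp add: gs_eq[of b k k])
  ultimately show ?thesis
    by (simp add: q_scale)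
qed

text \<open>The vector on the left is the component of the lattice vector orthogonal to
  \<open>b 1\<close>, ..., \<open>b (i - 1)\<close>, and Pythagoras applies.\<close>

lemma q_projection_le:
  fixes b :: "nat \<Rightarrow> 'a::star_division_algebra ^ 'm"
  assumes i: "i \<in> {1..d}"
  shows "q (\<Sum>l\<in>{i..d}. x l *s gs b l i) \<le> q (\<Sum>l\<in>{1..d}. x l *s b l)"
proof -
  let ?p = "\<lambda>l. \<Sum>j\<in>{1..<i}. gs_mu b l j *s gs b j j"
  define u where "u = (\<Sum>l\<in>{i..d}. x l *s gs b l i)"
  \<comment> \<open>The component in the span of the first \<open>i - 1\<close> basis vectors: the
    terms with \<open>l < i\<close>, together with the projections removed from the others.\<close>
  define r where "r = (\<Sum>l\<in>{1..<i}. x l *s b l) + (\<Sum>l\<in>{i..d}. x l *s ?p l)"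
  have u_gs: "hform u (gs b j j) = 0" if "1 \<le> j" "j < i" for j
    unfolding u_def hform_sum_left using that
    by (intro sum.neutral) (simp add: hform_scale_left gs_orthogonal)
  \<comment> \<open>For \<open>l < i\<close>, \<open>b l\<close> is a combination of Gram-Schmidt
    vectors of index at most \<open>l\<close>, all orthogonal to \<open>u\<close>.\<close>
  have u_b: "hform u (b l) = 0" if "1 \<le> l" "l < i" for l
  proof -
    have "b l = gs b l l + (\<Sum>j\<in>{1..<l}. gs_mu b l j *s gs b j j)"
      by (simp add: gs_eq[of b l l])
    also have "hform u \<dots> = 0"
      using that by (simp add: hform_add_right hform_sum_right hform_scale_right u_gs)
    finally show ?thesis .
  qed
  have "hform u r = 0"
    by (simp add: r_def hform_add_right hform_sum_right hform_scale_right u_gs u_b)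
  then have "q (u + r) = q u + q r"
    by (rule q_add_orthogonal)
  moreover have "(\<Sum>l\<in>{1..d}. x l *s b l) = u + r"
  proof -
    have "{1..d} = {1..<i} \<union> {i..d}"
      using i by auto
    then have "(\<Sum>l\<in>{1..d}. x l *s b l) = (\<Sum>l\<in>{1..<i}. x l *s b l) + (\<Sum>l\<in>{i..d}. x l *s b l)"
      by (simp only:) (rule sum.union_disjoint, auto)
    moreover have "x l *s b l = x l *s gs b l i + x l *s ?p l" for l
      by (simp add: gs_eq[of b l i] vec_eq_iff algebra_simps)
    ultimately show ?thesis
      by (simp add: u_def r_def sum.distrib add_ac)
  qed
  ultimately show ?thesis
    using q_nonneg[of r] by (simp add: u_def)
qed


section \<open>Linear dependence and successive minima\<close>

text \<open>More rows than columns force a left relation among the rows. This is Gaussian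
  elimination over a skew field, removing one column per induction step.\<close>

lemma (in star_subfield) nontrivial_left_relation:
  assumes "finite L" "finite J" "card L < card J" "\<And>j l. j \<in> J \<Longrightarrow> l \<in> L \<Longrightarrow> A j l \<in> K"
  shows "\<exists>c. (\<forall>j. c j \<in> K) \<and> (\<exists>j\<in>J. c j \<noteq> 0) \<and> (\<forall>l\<in>L. (\<Sum>j\<in>J. c j * A j l) = 0)"
  using assms
proof (induction L arbitrary: J A rule: finite_induct)
  case empty
  then have "J \<noteq> {}"
    by auto
  then show ?case
    by (intro exI[of _ "\<lambda>_. 1"]) (auto simp: one_closed)
next
  case (insert m L)
  show ?case
  proof (cases "\<forall>j\<in>J. A j m = 0")
    case True
    have "\<exists>c. (\<forall>j. c j \<in> K) \<and> (\<exists>j\<in>J. c j \<noteq> 0) \<and> (\<forall>l\<in>L. (\<Sum>j\<in>J. c j * A j l) = 0)"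
      using insert by (intro insert.IH) auto
    with True show ?thesis
      by auto
  next
    case False
    then obtain p where p: "p \<in> J" "A p m \<noteq> 0"
      by blast
    \<comment> \<open>Subtracting \<open>t j\<close> times the pivot row \<open>p\<close> clears
      column \<open>m\<close> of row \<open>j\<close>. The multiplier stands on the left, where the
      relation's coefficients act.\<close>
    define t where "t j = A j m * inverse (A p m)" for j
    have t: "t j \<in> K" if "j \<in> J" for j
      using that p insert.prems by (auto simp: t_def intro!: mult_closed inverse_closed)
    have "\<exists>c. (\<forall>j. c j \<in> K) \<and> (\<exists>j\<in>J - {p}. c j \<noteq> 0) \<and>
        (\<forall>l\<in>L. (\<Sum>j\<in>J - {p}. c j * (A j l - t j * A p l)) = 0)"
      using insert p t by (intro insert.IH) (auto intro!: diff_closed mult_closed)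
    then obtain c where c: "\<And>j. c j \<in> K" "\<exists>j\<in>J - {p}. c j \<noteq> 0"
      "\<And>l. l \<in> L \<Longrightarrow> (\<Sum>j\<in>J - {p}. c j * (A j l - t j * A p l)) = 0"
      by blast
    \<comment> \<open>The coefficient at \<open>p\<close> is chosen so that combining the original
      rows gives the same result as combining the reduced rows.\<close>
    define c' where "c' = c(p := - (\<Sum>j\<in>J - {p}. c j * t j))"
    have sum_c': "(\<Sum>j\<in>J. c' j * A j l) = (\<Sum>j\<in>J - {p}. c j * (A j l - t j * A p l))" for l
    proof -
      have "(\<Sum>j\<in>J. c' j * A j l) = c' p * A p l + (\<Sum>j\<in>J - {p}. c' j * A j l)"
        using p insert.prems by (simp add: sum.remove)
      also have "(\<Sum>j\<in>J - {p}. c' j * A j l) = (\<Sum>j\<in>J - {p}. c j * A j l)"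
        by (intro sum.cong) (auto simp: c'_def)
      finally show ?thesis
        by (simp add: c'_def right_diff_distrib sum_subtractf sum_distrib_right mult.assoc)
    qed
    have "(\<Sum>j\<in>J. c' j * A j l) = 0" if "l \<in> insert m L" for l
    proof (cases "l = m")
      case True
      then show ?thesis
        using p by (simp add: sum_c' t_def mult.assoc)
    qed (use that c(3) in \<open>simp add: sum_c'\<close>)
    moreover have "c' j \<in> K" for j
      using c(1) t by (auto simp: c'_def intro!: uminus_closed sum_closed mult_closed)
    moreover have "\<exists>j\<in>J. c' j \<noteq> 0"
      using c(2) by (auto simp: c'_def)
    ultimately show ?thesis
      by blast
  qed
qed

text \<open>Otherwise the \<open>k\<close> coordinate rows would have at most \<open>i - 1\<close>
  nonzero columns, and a left relation among these rows would carry over to the vectors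
  \<open>v j\<close>.\<close>

lemma (in star_subfield) independent_coordinate:
  fixes b :: "nat \<Rightarrow> 'a ^ 'm"
  assumes ind: "left_independent K k v" and i: "1 \<le> i" "i \<le> k"
    and v: "\<And>j. j \<in> {1..k} \<Longrightarrow> v j = (\<Sum>l\<in>{1..d}. x j l *s b l)"
    and x: "\<And>j l. j \<in> {1..k} \<Longrightarrow> l \<in> {1..d} \<Longrightarrow> x j l \<in> K"
  shows "\<exists>j\<in>{1..k}. \<exists>l\<in>{i..d}. x j l \<noteq> 0"
proof (rule ccontr)
  assume "\<not> ?thesis"
  then have zero: "x j l = 0" if "j \<in> {1..k}" "l \<in> {i..d}" for j l
    using that by blast
  \<comment> \<open>The intersection with \<open>{1..d}\<close> matters because the coordinates are
    known to lie in \<open>K\<close> only there.\<close>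
  let ?L = "{1..<i} \<inter> {1..d}"
  have "card ?L \<le> card {1..<i}"
    by (intro card_mono) auto
  then have "card ?L < card {1..k}"
    using i by simp
  then obtain c where c: "\<And>j. c j \<in> K" "\<exists>j\<in>{1..k}. c j \<noteq> 0"
      "\<And>l. l \<in> ?L \<Longrightarrow> (\<Sum>j\<in>{1..k}. c j * x j l) = 0"
    using nontrivial_left_relation[of ?L "{1..k}" x] x by (metis IntD2 finite_Int finite_atLeastAtMost)
  have col: "(\<Sum>j\<in>{1..k}. c j * x j l) = 0" if "l \<in> {1..d}" for l
  proof (cases "l < i")
    case False
    then show ?thesis
      using that zero by (intro sum.neutral) auto
  qed (use that c(3) in auto)
  have "(\<Sum>j\<in>{1..k}. c j *s v j) $ n = 0" for n
  proof -
    have "(\<Sum>j\<in>{1..k}. c j *s v j) $ n = (\<Sum>j\<in>{1..k}. \<Sum>l\<in>{1..d}. c j * x j l * b l $ n)"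
      by (simp add: v sum_distrib_left mult.assoc)
    also have "\<dots> = (\<Sum>l\<in>{1..d}. (\<Sum>j\<in>{1..k}. c j * x j l) * b l $ n)"
      by (subst sum.swap) (simp add: sum_distrib_right)
    finally show ?thesis
      using col by simp
  qed
  then have "(\<Sum>j\<in>{1..k}. c j *s v j) = 0"
    by (simp add: vec_eq_iff)
  then show False
    using ind c(1,2) unfolding left_independent_def by blast
qed

text \<open>Lets the first \<open>k\<close> basis vectors compete in the definition of the
  \<open>k\<close>-th successive minimum. Coefficients are extended by zero.\<close>

lemma left_independent_mono:
  assumes "left_independent K n v" "0 \<in> K" "m \<le> n"
  shows "left_independent K m v"
  unfolding left_independent_def
proof (intro allI impI)
  fix c assume c: "(\<forall>i\<in>{1..m}. c i \<in> K) \<and> (\<Sum>i\<in>{1..m}. c i *s v i) = 0"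
  define c' where "c' i = (if i \<le> m then c i else 0)" for i
  have "(\<Sum>i\<in>{1..n}. c' i *s v i) = (\<Sum>i\<in>{1..m}. c i *s v i)"
    using assms(3) by (intro sum.mono_neutral_cong_right) (auto simp: c'_def)
  moreover have "\<forall>i\<in>{1..n}. c' i \<in> K"
    using c assms(2) by (auto simp: c'_def)
  ultimately have "\<forall>i\<in>{1..n}. c' i = 0"
    using assms(1) c unfolding left_independent_def by auto
  then show "\<forall>i\<in>{1..m}. c i = 0"
    using assms(3) unfolding c'_def by (metis atLeastAtMost_iff order_trans)
qed

text \<open>Every radius \<open>r\<close> admitting \<open>k\<close> independent lattice vectors is
  at least the length of \<open>gs b i i\<close>: one of these vectors has a nonzero coordinate at
  or beyond \<open>i\<close>, and its projection competes in the HKZ minimum at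
  \<open>i\<close>.\<close>

lemma (in star_subfield) gs_le_successive_minimum:
  fixes b :: "nat \<Rightarrow> 'a ^ 'm"
  assumes ord: "is_order K \<O>" and basis: "lattice_basis K \<O> d b \<Lambda>" and red: "hkz_reduced \<O> d b"
    and i: "1 \<le> i" "i \<le> k" "k \<le> d"
  shows "sqrt (q (gs b i i)) \<le> successive_minimum K \<Lambda> k"
  unfolding successive_minimum_def
proof (rule cInf_greatest)
  have b: "left_independent K d b"
    and \<Lambda>: "\<Lambda> = {\<Sum>i\<in>{1..d}. x i *s b i |x. \<forall>i\<in>{1..d}. x i \<in> \<O>}"
    using basis unfolding lattice_basis_def by auto
  \<comment> \<open>The infimum is meaningful only over a nonempty set: the vectors
    \<open>b 1\<close>, ..., \<open>b k\<close> are admissible, with the sum of their lengths as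
    common radius.\<close>
  have "b j \<in> \<Lambda>" if "j \<in> {1..k}" for j
  proof -
    have "b j = (\<Sum>l\<in>{1..d}. (if l = j then 1 else 0) *s b l)"
      using that i by (simp add: if_distrib[of "\<lambda>c. c *s _"] cong: if_cong)
    then show ?thesis
      unfolding \<Lambda> using is_orderD(2,3)[OF ord]
      by (intro CollectI exI[of _ "\<lambda>l. if l = j then 1 else 0"]) auto
  qed
  moreover have "sqrt (q (b j)) \<le> (\<Sum>l\<in>{1..k}. sqrt (q (b l)))" if "j \<in> {1..k}" for j
    using that by (intro member_le_sum) auto
  moreover have "left_independent K k b"
    using b zero_closed i(3) by (rule left_independent_mono)
  ultimately show "{r. \<exists>v. (\<forall>j\<in>{1..k}. v j \<in> \<Lambda> \<and> sqrt (q (v j)) \<le> r) \<and> left_independent K k v} \<noteq> {}"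
    by blast
  fix r assume "r \<in> {r. \<exists>v. (\<forall>j\<in>{1..k}. v j \<in> \<Lambda> \<and> sqrt (q (v j)) \<le> r) \<and> left_independent K k v}"
  then obtain v where v: "\<And>j. j \<in> {1..k} \<Longrightarrow> v j \<in> \<Lambda>" "\<And>j. j \<in> {1..k} \<Longrightarrow> sqrt (q (v j)) \<le> r"
    and ind: "left_independent K k v"
    by blast
  have "\<forall>j. \<exists>x. j \<in> {1..k} \<longrightarrow> v j = (\<Sum>l\<in>{1..d}. x l *s b l) \<and> (\<forall>l\<in>{1..d}. x l \<in> \<O>)"
    using v(1) unfolding \<Lambda> by blast
  then obtain x where x: "\<And>j. j \<in> {1..k} \<Longrightarrow> v j = (\<Sum>l\<in>{1..d}. x j l *s b l)"
    "\<And>j l. j \<in> {1..k} \<Longrightarrow> l \<in> {1..d} \<Longrightarrow> x j l \<in> \<O>"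
    by metis
  obtain j where j: "j \<in> {1..k}" "\<exists>l\<in>{i..d}. x j l \<noteq> 0"
    using independent_coordinate[OF ind i(1,2) x(1)] x(2) is_orderD(1)[OF ord] by blast
  have "is_min {q (\<Sum>l\<in>{i..d}. y l *s gs b l i) |y.
      (\<forall>l\<in>{i..d}. y l \<in> \<O>) \<and> (\<exists>l\<in>{i..d}. y l \<noteq> 0)} (q (gs b i i))"
    using red i unfolding hkz_reduced_def by auto
  moreover have "\<forall>l\<in>{i..d}. x j l \<in> \<O>"
    using x(2) j(1) i by auto
  ultimately have "q (gs b i i) \<le> q (\<Sum>l\<in>{i..d}. x j l *s gs b l i)"
    using j(2) unfolding is_min_def by blast
  also have "\<dots> \<le> q (v j)"
    unfolding x(1)[OF j(1)] using i by (intro q_projection_le) auto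
  finally show "sqrt (q (gs b i i)) \<le> r"
    using v(2)[OF j(1)] by (meson order_trans real_sqrt_le_mono)
qed

section \<open>The bound on the reduced basis vectors\<close>

theorem theorem7:
  fixes K \<O> :: "'a::star_division_algebra set"
    and \<Lambda> :: "('a ^ 'm) set"
    and b :: "nat \<Rightarrow> 'a ^ 'm"
    and d :: nat
  assumes "imaginary_quadratic_field K \<or> rational_quaternion_field K"
    and "maximal_order K \<O>"
    and "lattice_basis K \<O> d b \<Lambda>"
    and "hkz_reduced \<O> d b"
  shows "\<forall>k. 1 \<le> k \<and> k \<le> d \<longrightarrow>
    q (b k) \<le> (1 + (real k - 1) * euclidean_minimum K \<O>) * (successive_minimum K \<Lambda> k)\<^sup>2"
proof (intro allI impI)
  fix k assume k: "1 \<le> k \<and> k \<le> d"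
  interpret star_subfield K
    using assms(1)
    by (elim disjE imaginary_quadratic_field_properties(1) rational_quaternion_field_properties(1))
  obtain E where E: "finite E" "E \<subseteq> K" "K \<subseteq> span E"
    using assms(1) imaginary_quadratic_field_properties(2)[of K]
      rational_quaternion_field_properties(2)[of K] by metis
  have ord: "is_order K \<O>"
    using assms(2) by (simp add: maximal_order_def)
  let ?M = "euclidean_minimum K \<O>" and ?m = "successive_minimum K \<Lambda> k"
  have gs: "q (gs b i i) \<le> ?m\<^sup>2" if "i \<in> {1..k}" for i
  proof -
    have "sqrt (q (gs b i i)) \<le> ?m"
      using gs_le_successive_minimum[OF ord assms(3,4)] that k by auto
    then show ?thesis
      by (rule sqrt_le_D)
  qed
  have mu: "nrd (gs_mu b k i) \<le> ?M" if "i \<in> {1..<k}" for i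
  proof (rule is_min_nrd_le_euclidean_minimum[OF ord E])
    have "b l $ j \<in> K" if "l \<in> {1..d}" for l j
      using that assms(3) by (auto simp: lattice_basis_def)
    then show "gs_mu b k i \<in> K"
      using that k by (intro gs_mu_closed[where d = d]) auto
    show "is_min {nrd (gs_mu b k i - y) |y. y \<in> \<O>} (nrd (gs_mu b k i))"
      using assms(4) that k unfolding hkz_reduced_def by auto
  qed
  have "q (b k) = q (gs b k k) + (\<Sum>i\<in>{1..<k}. nrd (gs_mu b k i) * q (gs b i i))"
    using k by (intro q_basis_eq) simp
  also have "\<dots> \<le> ?m\<^sup>2 + (\<Sum>i\<in>{1..<k}. ?M * ?m\<^sup>2)"
  proof (intro add_mono sum_mono mult_mono)
    \<comment> \<open>Nonnegativity of \<open>?M\<close> is read off from the bound on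
      \<open>gs_mu b k i\<close>, since an index \<open>i\<close> is available inside the
      sum.\<close>
    fix i assume i: "i \<in> {1..<k}"
    show "0 \<le> ?M"
      using mu[OF i] nrd_nonneg order_trans by blast
  qed (use gs mu k in auto)
  \<comment> \<open>The sum has \<open>k - 1\<close> equal terms; since \<open>k\<close> is at least
    1, the natural-number subtraction agrees with the real one.\<close>
  also have "\<dots> = (1 + (real k - 1) * ?M) * ?m\<^sup>2"
    using k by (simp add: of_nat_diff algebra_simps)
  finally show "q (b k) \<le> (1 + (real k - 1) * ?M) * ?m\<^sup>2" .
qed

end
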